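(* Let $(\boldsymbol{x},\boldsymbol{n},\boldsymbol{s}):U\to\mathbb{R}^3\times\Delta$ be a framed surface with basic invariants $a_i,b_i,e_i,f_i,g_i$ ($i=1,2$). Then $(\boldsymbol{x},\boldsymbol{n},\boldsymbol{s})$ is a $(\boldsymbol{t},\overline{\boldsymbol{t}})$-Bertrand framed surface if and only if there exist smooth functions $\lambda,\widetilde\theta:U\to\mathbb{R}$ with $\lambda\not\equiv0$ such that $$\begin{pmatrix} \lambda(u,v)f_1(u,v) & a_1(u,v)-\lambda(u,v)g_1(u,v)\\ \lambda(u,v)f_2(u,v) & a_2(u,v)-\lambda(u,v)g_2(u,v)\end{pmatrix}\begin{pmatrix}\cos\widetilde\theta(u,v)\\ \sin\widetilde\theta(u,v)\end{pmatrix}=\begin{pmatrix}0\\0\end{pmatrix}$$ for all $(u,v)\in U$.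
   Context: All maps are $C^\infty$. $U\subset\mathbb{R}^2$ is a simply connected domain with coordinates $(u,v)$, $S^2$ is the unit sphere in $\mathbb{R}^3$, and $\Delta=\{(\boldsymbol{a},\boldsymbol{b})\in S^2\times S^2 : \boldsymbol{a}\cdot\boldsymbol{b}=0\}$. A framed surface is a smooth map $(\boldsymbol{x},\boldsymbol{n},\boldsymbol{s}):U\to\mathbb{R}^3\times\Delta$ with $\boldsymbol{x}_u\cdot\boldsymbol{n}=\boldsymbol{x}_v\cdot\boldsymbol{n}=0$ on $U$. Put $\boldsymbol{t}=\boldsymbol{n}\times\boldsymbol{s}$. Its basic invariants are the smooth functions $a_i,b_i,e_i,f_i,g_i:U\to\mathbb{R}$ ($i=1,2$) determined by $\boldsymbol{x}_u=a_1\boldsymbol{s}+b_1\boldsymbol{t}$, $\boldsymbol{n}_u=e_1\boldsymbol{s}+f_1\boldsymbol{t}$, $\boldsymbol{s}_u=-e_1\boldsymbol{n}+g_1\boldsymbol{t}$, $\boldsymbol{t}_u=-f_1\boldsymbol{n}-g_1\boldsymbol{s}$, and the same equations with $\partial_v$ in place of $\partial_u$ and index $2$ in place of $1$. For a smooth $\lambda:U\to\mathbb{R}$, $\lambda\not\equiv0$ means that $\{(u,v)\in U:\lambda(u,v)\neq0\}$ is dense in $U$. Two framed surfaces $(\boldsymbol{x},\boldsymbol{n},\boldsymbol{s}),(\overline{\boldsymbol{x}},\overline{\boldsymbol{n}},\overline{\boldsymbol{s}}):U\to\mathbb{R}^3\times\Delta$ (with $\overline{\boldsymbol{t}}=\overline{\boldsymbol{n}}\times\overline{\boldsymbol{s}}$)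 are $(\boldsymbol{v},\overline{\boldsymbol{w}})$-mates, where each of $\boldsymbol{v},\boldsymbol{w}$ is one of $\boldsymbol{n},\boldsymbol{s},\boldsymbol{t}$, if there is a smooth $\lambda:U\to\mathbb{R}$ with $\lambda\not\equiv0$ such that $\overline{\boldsymbol{x}}=\boldsymbol{x}+\lambda\boldsymbol{v}$ and $\boldsymbol{v}=\overline{\boldsymbol{w}}$ on $U$. $(\boldsymbol{x},\boldsymbol{n},\boldsymbol{s})$ is a $(\boldsymbol{v},\overline{\boldsymbol{w}})$-Bertrand framed surface if there is a framed surface $(\overline{\boldsymbol{x}},\overline{\boldsymbol{n}},\overline{\boldsymbol{s}}):U\to\mathbb{R}^3\times\Delta$ such that the two are $(\boldsymbol{v},\overline{\boldsymbol{w}})$-mates. *)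

theory Defs
  imports "HOL-Analysis.Analysis"
begin

text \<open>Smoothness is only used on open sets, so derivatives are taken at full neighbourhoods and the
  values of a function off the set are irrelevant.\<close>

primrec Ck_on :: "nat \<Rightarrow> ('a::euclidean_space \<Rightarrow> 'b::real_normed_vector) \<Rightarrow> 'a set \<Rightarrow> bool" where
  "Ck_on 0 f U \<longleftrightarrow> continuous_on U f"
| "Ck_on (Suc k) f U \<longleftrightarrow>
     (\<forall>p\<in>U. f differentiable (at p)) \<and>
     (\<forall>h. Ck_on k (\<lambda>p. frechet_derivative f (at p) h) U)"

definition smooth_on :: "('a::euclidean_space \<Rightarrow> 'b::real_normed_vector) \<Rightarrow> 'a set \<Rightarrow> bool" where
  "smooth_on f U \<longleftrightarrow> (\<forall>k. Ck_on k f U)"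

text \<open>The coordinates \<open>u\<close>, \<open>v\<close> are the components \<open>1\<close>, \<open>2\<close> of a point of \<open>real^2\<close>, so
  \<open>partial_deriv 1 f\<close> is \<open>f\<^sub>u\<close> and \<open>partial_deriv 2 f\<close> is \<open>f\<^sub>v\<close>.\<close>

definition partial_deriv :: "2 \<Rightarrow> (real^2 \<Rightarrow> 'b::real_normed_vector) \<Rightarrow> real^2 \<Rightarrow> 'b" where
  "partial_deriv i f p = frechet_derivative f (at p) (axis i 1)"

definition Delta :: "((real^3) \<times> (real^3)) set" where
  "Delta = {(a, b). a \<in> sphere 0 1 \<and> b \<in> sphere 0 1 \<and> a \<bullet> b = 0}"

text \<open>In the definitions below a framed surface is given by its three components
  \<open>x\<close>, \<open>n\<close>, \<open>s\<close>.\<close>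

definition framed_surface ::
  "(real^2) set \<Rightarrow> (real^2 \<Rightarrow> real^3) \<Rightarrow> (real^2 \<Rightarrow> real^3) \<Rightarrow> (real^2 \<Rightarrow> real^3) \<Rightarrow> bool" where
  "framed_surface U x n s \<longleftrightarrow>
     smooth_on x U \<and> smooth_on n U \<and> smooth_on s U \<and>
     (\<forall>p\<in>U. (n p, s p) \<in> Delta) \<and>
     (\<forall>p\<in>U. \<forall>i. partial_deriv i x p \<bullet> n p = 0)"

definition t_field :: "(real^2 \<Rightarrow> real^3) \<Rightarrow> (real^2 \<Rightarrow> real^3) \<Rightarrow> real^2 \<Rightarrow> real^3" where
  "t_field n s p = cross3 (n p) (s p)"

text \<open>The index \<open>i :: 2\<close> of the basic invariants runs over \<open>1\<close> and \<open>2\<close>.\<close>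

definition basic_invariants ::
  "(real^2) set \<Rightarrow> (real^2 \<Rightarrow> real^3) \<Rightarrow> (real^2 \<Rightarrow> real^3) \<Rightarrow> (real^2 \<Rightarrow> real^3) \<Rightarrow>
   (2 \<Rightarrow> real^2 \<Rightarrow> real) \<Rightarrow> (2 \<Rightarrow> real^2 \<Rightarrow> real) \<Rightarrow> (2 \<Rightarrow> real^2 \<Rightarrow> real) \<Rightarrow>
   (2 \<Rightarrow> real^2 \<Rightarrow> real) \<Rightarrow> (2 \<Rightarrow> real^2 \<Rightarrow> real) \<Rightarrow> bool" where
  "basic_invariants U x n s a b e f g \<longleftrightarrow>
     (\<forall>i. smooth_on (a i) U \<and> smooth_on (b i) U \<and> smooth_on (e i) U \<and>
          smooth_on (f i) U \<and> smooth_on (g i) U) \<and>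
     (\<forall>p\<in>U. \<forall>i.
        partial_deriv i x p = a i p *\<^sub>R s p + b i p *\<^sub>R t_field n s p \<and>
        partial_deriv i n p = e i p *\<^sub>R s p + f i p *\<^sub>R t_field n s p \<and>
        partial_deriv i s p = - e i p *\<^sub>R n p + g i p *\<^sub>R t_field n s p \<and>
        partial_deriv i (t_field n s) p = - f i p *\<^sub>R n p - g i p *\<^sub>R s p)"

text \<open>The relation written \<open>\<lambda> \<not>\<equiv> 0\<close>; it is stronger than \<open>\<lambda>\<close> not vanishing identically.\<close>

definition densely_nonzero :: "(real^2) set \<Rightarrow> (real^2 \<Rightarrow> real) \<Rightarrow> bool" where
  "densely_nonzero U l \<longleftrightarrow> U \<subseteq> closure {p\<in>U. l p \<noteq> 0}"

datatype frame_vector = Frame_n | Frame_s | Frame_t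

primrec frame_field ::
  "frame_vector \<Rightarrow> (real^2 \<Rightarrow> real^3) \<Rightarrow> (real^2 \<Rightarrow> real^3) \<Rightarrow> real^2 \<Rightarrow> real^3" where
  "frame_field Frame_n n s = n"
| "frame_field Frame_s n s = s"
| "frame_field Frame_t n s = t_field n s"

definition mates ::
  "frame_vector \<Rightarrow> frame_vector \<Rightarrow> (real^2) set \<Rightarrow>
   (real^2 \<Rightarrow> real^3) \<Rightarrow> (real^2 \<Rightarrow> real^3) \<Rightarrow> (real^2 \<Rightarrow> real^3) \<Rightarrow>
   (real^2 \<Rightarrow> real^3) \<Rightarrow> (real^2 \<Rightarrow> real^3) \<Rightarrow> (real^2 \<Rightarrow> real^3) \<Rightarrow> bool" where
  "mates v w U x n s x' n' s' \<longleftrightarrow>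
     framed_surface U x n s \<and> framed_surface U x' n' s' \<and>
     (\<exists>l. smooth_on l U \<and> densely_nonzero U l \<and>
        (\<forall>p\<in>U. x' p = x p + l p *\<^sub>R frame_field v n s p \<and>
               frame_field v n s p = frame_field w n' s' p))"

definition Bertrand_framed_surface ::
  "frame_vector \<Rightarrow> frame_vector \<Rightarrow> (real^2) set \<Rightarrow>
   (real^2 \<Rightarrow> real^3) \<Rightarrow> (real^2 \<Rightarrow> real^3) \<Rightarrow> (real^2 \<Rightarrow> real^3) \<Rightarrow> bool" where
  "Bertrand_framed_surface v w U x n s \<longleftrightarrow> (\<exists>x' n' s'. mates v w U x n s x' n' s')"

end

theory Submission
  imports Defs
begin

text \<open>
  Write \<open>t = n \<times> s\<close> and \<open>x' = x + \<lambda>t\<close>, with an index \<open>i\<close> on \<open>x'\<close> and \<open>\<lambda>\<close> for the partial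
  derivatives. The structure equations give
  \<open>x'\<^sub>i = (a\<^sub>i - \<lambda>g\<^sub>i) s + (b\<^sub>i + \<lambda>\<^sub>i) t - \<lambda>f\<^sub>i n\<close>.
  A frame with the same third vector \<open>t\<close> differs from the given one by a rotation of the plane
  spanned by \<open>n\<close> and \<open>s\<close>, so its first vector is \<open>n' = c n + d s\<close> with \<open>c\<^sup>2 + d\<^sup>2 = 1\<close>, and it is
  normal to \<open>x'\<close> exactly when \<open>-\<lambda>f\<^sub>i c + (a\<^sub>i - \<lambda>g\<^sub>i) d = 0\<close> for \<open>i = 1, 2\<close>. With
  \<open>c = -cos \<theta>\<close> and \<open>d = sin \<theta>\<close> these are the two rows of the matrix equation.

  Conversely, an angle \<open>\<theta>\<close> yields the frame \<open>n' = -cos \<theta> n + sin \<theta> s\<close>,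
  \<open>s' = -sin \<theta> n - cos \<theta> s\<close>, whose cross product is again \<open>t\<close>. The only global ingredient is
  that the map \<open>(-c, d)\<close> into the unit circle has a smooth angle function
  (\<open>smooth_on_angle_exists\<close>): simple connectedness gives a continuous angle, and a
  continuous angle of a smooth map is automatically smooth
  (\<open>smooth_on_continuous_angle\<close>).
\<close>

section \<open>Calculus of smooth maps on open sets\<close>

text \<open>Derivatives are taken at full neighbourhoods, but on an open set they still depend only on the
  values in \<open>U\<close>; hence so does the whole hierarchy \<open>Ck_on\<close>.\<close>

lemma Ck_on_cong:
  assumes "open U" "\<And>p. p \<in> U \<Longrightarrow> f p = g p" "Ck_on k f U"
  shows "Ck_on k g U"
  using assms(2,3)
proof (induction k arbitrary: f g)
  case 0
  have "continuous_on U f = continuous_on U g"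
    by (rule continuous_on_cong[OF refl 0(1)])
  then show ?case using 0(2) by (simp only: Ck_on.simps)
next
  case (Suc k)
  have D: "(g has_derivative frechet_derivative f (at p)) (at p)" if "p \<in> U" for p
  proof -
    have "(f has_derivative frechet_derivative f (at p)) (at p)"
      using Suc.prems(2) that by (simp add: frechet_derivative_works[symmetric])
    then show ?thesis
      by (rule has_derivative_transform_within_open[OF _ \<open>open U\<close> that Suc.prems(1)])
  qed
  have "Ck_on k (\<lambda>p. frechet_derivative g (at p) h) U" for h
  proof (rule Suc.IH)
    show "Ck_on k (\<lambda>p. frechet_derivative f (at p) h) U" using Suc.prems(2) by simp
    show "frechet_derivative f (at p) h = frechet_derivative g (at p) h" if "p \<in> U" for p
      by (rule fun_cong[OF frechet_derivative_at[OF D[OF that]]])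
  qed
  moreover have "\<forall>p\<in>U. g differentiable (at p)" by (rule ballI, rule differentiableI, rule D)
  ultimately show ?case by simp
qed

text \<open>The form in which a calculus rule enters an induction on \<open>k\<close>: the rule differentiates a sum, a
  product or a composition with \<open>cos\<close> or \<open>sin\<close>, and the resulting formula, valid on \<open>U\<close> only, is recognised as a \<open>k\<close> times
  continuously differentiable function of the point.\<close>

lemma Ck_on_SucI:
  assumes "open U" "\<And>p. p \<in> U \<Longrightarrow> (f has_derivative F p) (at p)"
    and "\<And>h. Ck_on k (\<lambda>p. F p h) U"
  shows "Ck_on (Suc k) f U"
proof -
  have "Ck_on k (\<lambda>p. frechet_derivative f (at p) h) U" for h
  proof (rule Ck_on_cong[OF assms(1) _ assms(3)[of h]])
    show "F p h = frechet_derivative f (at p) h" if "p \<in> U" for p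
      by (rule fun_cong[OF frechet_derivative_at[OF assms(2)[OF that]]])
  qed
  moreover have "\<forall>p\<in>U. f differentiable (at p)"
    by (rule ballI, rule differentiableI, rule assms(2))
  ultimately show ?thesis by simp
qed

lemma Ck_on_SucD: "Ck_on (Suc k) f U \<Longrightarrow> Ck_on k f U"
proof (induction k arbitrary: f)
  case 0
  then show ?case
    by (auto intro!: continuous_at_imp_continuous_on differentiable_imp_continuous_within)
qed auto

lemma Ck_on_Suc_has_derivative:
  "Ck_on (Suc k) f U \<Longrightarrow> p \<in> U \<Longrightarrow> (f has_derivative frechet_derivative f (at p)) (at p)"
  by (simp add: frechet_derivative_works[symmetric])

lemma Ck_on_add:
  assumes "open U" "Ck_on k f U" "Ck_on k g U"
  shows "Ck_on k (\<lambda>p. f p + g p) U"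
  using assms(2,3)
proof (induction k arbitrary: f g)
  case 0
  then show ?case by (auto intro: continuous_on_add)
next
  case (Suc k)
  show ?case
    by (rule Ck_on_SucI[OF \<open>open U\<close> has_derivative_add[OF
          Ck_on_Suc_has_derivative[OF Suc.prems(1)] Ck_on_Suc_has_derivative[OF Suc.prems(2)]]])
      (use Suc in auto)
qed

lemma (in bounded_bilinear) Ck_on_prod:
  assumes "open U" "Ck_on k f U" "Ck_on k g U"
  shows "Ck_on k (\<lambda>p. prod (f p) (g p)) U"
  using assms(2,3)
proof (induction k arbitrary: f g)
  case 0
  then show ?case by (auto intro: continuous_on)
next
  case (Suc k)
  show ?case
  proof (rule Ck_on_SucI[OF \<open>open U\<close> FDERIV[OF
          Ck_on_Suc_has_derivative[OF Suc.prems(1)] Ck_on_Suc_has_derivative[OF Suc.prems(2)]]])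
    show "Ck_on k (\<lambda>p. prod (f p) (frechet_derivative g (at p) h) +
        prod (frechet_derivative f (at p) h) (g p)) U" for h
      using Suc.prems Suc.prems[THEN Ck_on_SucD]
      by (intro Ck_on_add \<open>open U\<close> Suc.IH) auto
  qed
qed

lemma Ck_on_const: "Ck_on k (\<lambda>p. c) U"
  by (induction k arbitrary: c) auto

lemma Ck_on_minus:
  fixes f :: "'a::euclidean_space \<Rightarrow> 'b::real_normed_vector"
  assumes "open U" "Ck_on k f U"
  shows "Ck_on k (\<lambda>p. - f p) U"
  using bounded_bilinear.Ck_on_prod[OF bounded_bilinear_scaleR \<open>open U\<close> Ck_on_const assms(2),
      of "-1"]
  by simp

text \<open>Each of the two functions occurs in the derivative of the other, hence one joint induction.\<close>

lemma Ck_on_cos_sin: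
  fixes f :: "'a::euclidean_space \<Rightarrow> real"
  assumes "open U" "Ck_on k f U"
  shows "Ck_on k (\<lambda>p. cos (f p)) U \<and> Ck_on k (\<lambda>p. sin (f p)) U"
  using assms(2)
proof (induction k)
  case 0
  then show ?case by (auto intro!: continuous_intros)
next
  case (Suc k)
  note mult = bounded_bilinear.Ck_on_prod[OF bounded_bilinear_mult \<open>open U\<close>]
  note D = Ck_on_Suc_has_derivative[OF Suc.prems]
  have IH: "Ck_on k (\<lambda>p. cos (f p)) U" "Ck_on k (\<lambda>p. sin (f p)) U"
    using Suc.IH[OF Ck_on_SucD[OF Suc.prems]] by auto
  have f': "Ck_on k (\<lambda>p. frechet_derivative f (at p) h) U" for h
    using Suc.prems by simp
  show ?case
  proof
    show "Ck_on (Suc k) (\<lambda>p. cos (f p)) U"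
      by (rule Ck_on_SucI[OF \<open>open U\<close> has_derivative_cos[OF D]])
        (auto intro!: mult Ck_on_minus \<open>open U\<close> IH f')
    show "Ck_on (Suc k) (\<lambda>p. sin (f p)) U"
      by (rule Ck_on_SucI[OF \<open>open U\<close> has_derivative_sin[OF D]])
        (auto intro!: mult IH f')
  qed
qed

context
  fixes U :: "'a::euclidean_space set"
  assumes U: "open U"
begin

lemma smooth_on_add:
  "smooth_on f U \<Longrightarrow> smooth_on g U \<Longrightarrow> smooth_on (\<lambda>p. f p + g p) U"
  using U by (auto simp: smooth_on_def intro: Ck_on_add)

lemma smooth_on_minus: "smooth_on f U \<Longrightarrow> smooth_on (\<lambda>p. - f p) U"
  using U by (auto simp: smooth_on_def intro: Ck_on_minus)

lemma smooth_on_bilinear: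
  "bounded_bilinear B \<Longrightarrow> smooth_on f U \<Longrightarrow> smooth_on g U \<Longrightarrow> smooth_on (\<lambda>p. B (f p) (g p)) U"
  using U by (auto simp: smooth_on_def intro: bounded_bilinear.Ck_on_prod)

lemma
  fixes f :: "'a \<Rightarrow> real"
  shows smooth_on_cos: "smooth_on f U \<Longrightarrow> smooth_on (\<lambda>p. cos (f p)) U"
    and smooth_on_sin: "smooth_on f U \<Longrightarrow> smooth_on (\<lambda>p. sin (f p)) U"
  using U by (simp_all add: smooth_on_def Ck_on_cos_sin)

lemmas smooth_on_intros = smooth_on_add smooth_on_minus smooth_on_cos smooth_on_sin
  smooth_on_bilinear[OF bounded_bilinear_scaleR] smooth_on_bilinear[OF bounded_bilinear_inner]

end

lemma smooth_on_imp_has_derivative: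
  "smooth_on f U \<Longrightarrow> p \<in> U \<Longrightarrow> (f has_derivative frechet_derivative f (at p)) (at p)"
  unfolding smooth_on_def by (metis Ck_on_Suc_has_derivative)

section \<open>Smooth angle functions\<close>

text \<open>Near \<open>p\<close> the continuous angle stays within \<open>\<pi>/2\<close> of \<open>\<theta> p\<close>, so
  \<open>\<theta> q - \<theta> p = arcsin (sin (\<theta> q - \<theta> p))\<close>, and the addition theorem writes the argument of
  \<open>arcsin\<close> in terms of \<open>cos \<theta>\<close> and \<open>sin \<theta>\<close>. This argument vanishes at \<open>q = p\<close>, where \<open>arcsin\<close>
  has derivative \<open>1\<close>.\<close>

lemma has_derivative_continuous_angle:
  fixes \<theta> :: "'a::euclidean_space \<Rightarrow> real"
  assumes "isCont \<theta> p"
    and C: "((\<lambda>q. cos (\<theta> q)) has_derivative C') (at p)"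
    and S: "((\<lambda>q. sin (\<theta> q)) has_derivative S') (at p)"
  shows "(\<theta> has_derivative (\<lambda>h. cos (\<theta> p) * S' h - sin (\<theta> p) * C' h)) (at p)"
proof -
  define \<phi> where "\<phi> q = sin (\<theta> q) * cos (\<theta> p) - cos (\<theta> q) * sin (\<theta> p)" for q
  have "\<phi> p = 0" by (simp add: \<phi>_def)
  have "(\<phi> has_derivative (\<lambda>h. S' h * cos (\<theta> p) - C' h * sin (\<theta> p))) (at p)"
    unfolding \<phi>_def by (intro has_derivative_diff has_derivative_mult_left C S)
  then have "((\<lambda>q. \<theta> p + arcsin (\<phi> q)) has_derivative
      (\<lambda>h. cos (\<theta> p) * S' h - sin (\<theta> p) * C' h)) (at p)"
    by (auto intro!: derivative_eq_intros simp: \<open>\<phi> p = 0\<close> algebra_simps)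
  moreover have "\<forall>\<^sub>F q in at p. \<theta> p + arcsin (\<phi> q) = \<theta> q"
  proof -
    have "\<forall>\<^sub>F q in at p. dist (\<theta> q) (\<theta> p) < pi/2"
      using assms(1) pi_half_gt_zero unfolding isCont_def by (rule tendstoD)
    then show ?thesis
    proof eventually_elim
      case (elim q)
      have "\<phi> q = sin (\<theta> q - \<theta> p)" by (simp add: \<phi>_def sin_diff)
      moreover have "arcsin (sin (\<theta> q - \<theta> p)) = \<theta> q - \<theta> p"
        using elim[unfolded dist_real_def] by (intro arcsin_sin) linarith+
      ultimately show ?case by simp
    qed
  qed
  ultimately show ?thesis
    by (rule has_derivative_transform_eventually) (auto simp: \<open>\<phi> p = 0\<close>)
qed

text \<open>The derivative \<open>cos \<theta> \<cdot> d(sin \<theta>) - sin \<theta> \<cdot> d(cos \<theta>)\<close> involves \<open>\<theta>\<close> only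
  through the smooth functions \<open>cos \<theta>\<close> and \<open>sin \<theta>\<close>, so one differentiation of \<open>\<theta>\<close> gives
  smoothness of every order at once.\<close>

lemma smooth_on_continuous_angle:
  fixes \<theta> :: "'a::euclidean_space \<Rightarrow> real"
  assumes "open U" "continuous_on U \<theta>"
    and C: "smooth_on (\<lambda>p. cos (\<theta> p)) U" and S: "smooth_on (\<lambda>p. sin (\<theta> p)) U"
  shows "smooth_on \<theta> U"
  unfolding smooth_on_def
proof
  fix k
  note mult = bounded_bilinear.Ck_on_prod[OF bounded_bilinear_mult \<open>open U\<close>]
  let ?D = "\<lambda>p h. cos (\<theta> p) * frechet_derivative (\<lambda>p. sin (\<theta> p)) (at p) h -
      sin (\<theta> p) * frechet_derivative (\<lambda>p. cos (\<theta> p)) (at p) h"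
  have "Ck_on (Suc k) \<theta> U"
  proof (rule Ck_on_SucI[OF \<open>open U\<close>])
    show "(\<theta> has_derivative ?D p) (at p)" if "p \<in> U" for p
      using assms that
      by (intro has_derivative_continuous_angle smooth_on_imp_has_derivative[of _ U])
        (auto simp: continuous_on_eq_continuous_at)
    have "Ck_on (Suc k) (\<lambda>p. sin (\<theta> p)) U" "Ck_on (Suc k) (\<lambda>p. cos (\<theta> p)) U"
      using C S unfolding smooth_on_def by blast+
    then have
      "Ck_on k (\<lambda>p. frechet_derivative (\<lambda>p. sin (\<theta> p)) (at p) h) U"
      "Ck_on k (\<lambda>p. frechet_derivative (\<lambda>p. cos (\<theta> p)) (at p) h) U" for h
      by auto
    moreover have "Ck_on k (\<lambda>p. sin (\<theta> p)) U" "Ck_on k (\<lambda>p. cos (\<theta> p)) U"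
      using C S unfolding smooth_on_def by blast+
    ultimately show "Ck_on k (\<lambda>p. ?D p h) U" for h
      unfolding diff_conv_add_uminus by (intro Ck_on_add Ck_on_minus mult \<open>open U\<close>)
  qed
  then show "Ck_on k \<theta> U" by (rule Ck_on_SucD)
qed

text \<open>The continuous angle is the imaginary part of a continuous logarithm of the nowhere
  vanishing complex function \<open>c + \<i> d\<close>, whose real part \<open>ln \<bar>c + \<i> d\<bar>\<close> is \<open>0\<close>.\<close>

lemma smooth_on_angle_exists:
  fixes c d :: "'a::euclidean_space \<Rightarrow> real"
  assumes U: "open U" "simply_connected U"
    and c: "smooth_on c U" and d: "smooth_on d U"
    and unit: "\<And>p. p \<in> U \<Longrightarrow> (c p)\<^sup>2 + (d p)\<^sup>2 = 1"
  obtains \<theta> :: "'a \<Rightarrow> real"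
  where "smooth_on \<theta> U" "\<And>p. p \<in> U \<Longrightarrow> cos (\<theta> p) = c p" "\<And>p. p \<in> U \<Longrightarrow> sin (\<theta> p) = d p"
proof -
  let ?z = "\<lambda>p. Complex (c p) (d p)"
  have "Ck_on 0 c U" "Ck_on 0 d U" using c d unfolding smooth_on_def by blast+
  then have "continuous_on U ?z"
    by (simp add: Complex_eq continuous_on_add continuous_on_mult_left continuous_on_of_real)
  moreover have norm_z: "cmod (?z p) = 1" if "p \<in> U" for p
    using unit[OF that] by (simp add: cmod_def)
  then have "\<And>p. p \<in> U \<Longrightarrow> ?z p \<noteq> 0" by force
  ultimately obtain w where w: "continuous_on U w" "\<And>p. p \<in> U \<Longrightarrow> ?z p = exp (w p)"
    using continuous_logarithm_on_simply_connected[of U ?z] U open_imp_locally_path_connected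
    by metis
  define \<theta> where "\<theta> p = Im (w p)" for p
  have \<theta>: "cos (\<theta> p) = c p \<and> sin (\<theta> p) = d p" if "p \<in> U" for p
  proof -
    have "exp (Re (w p)) = 1" using norm_z[OF that] w(2)[OF that] by (simp add: norm_exp_eq_Re)
    then show ?thesis
      using w(2)[OF that] by (simp add: \<theta>_def complex_eq_iff Re_exp Im_exp)
  qed
  have "smooth_on \<theta> U"
  proof (rule smooth_on_continuous_angle[OF U(1)])
    show "continuous_on U \<theta>" unfolding \<theta>_def by (intro continuous_intros w(1))
    show "smooth_on (\<lambda>p. cos (\<theta> p)) U" "smooth_on (\<lambda>p. sin (\<theta> p)) U"
      using c d \<theta> Ck_on_cong[OF U(1), of c "\<lambda>p. cos (\<theta> p)"]
        Ck_on_cong[OF U(1), of d "\<lambda>p. sin (\<theta> p)"]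
      by (auto simp: smooth_on_def)
  qed
  then show thesis using \<theta> by (intro that) auto
qed

section \<open>Frames\<close>

lemma bounded_bilinear_cross3: "bounded_bilinear cross3"
  using bilinear_cross by (simp add: bilinear_conv_bounded_bilinear)

lemma smooth_on_t_field:
  "open U \<Longrightarrow> smooth_on n U \<Longrightarrow> smooth_on s U \<Longrightarrow> smooth_on (t_field n s) U"
  unfolding t_field_def by (rule smooth_on_bilinear[OF _ bounded_bilinear_cross3])

lemma orthonormal_pair_cross3:
  assumes "(n, s) \<in> Delta"
  shows "n \<bullet> n = 1" "s \<bullet> s = 1" "n \<bullet> s = 0" "s \<bullet> n = 0"
    "cross3 n s \<bullet> cross3 n s = 1" "cross3 n s \<bullet> n = 0" "cross3 n s \<bullet> s = 0"
    "n \<bullet> cross3 n s = 0" "s \<bullet> cross3 n s = 0"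
  using assms by (auto simp: Delta_def norm_eq_1 inner_commute dot_cross dot_cross_self)

text \<open>For a vector \<open>w\<close> orthogonal to \<open>t = n \<times> s\<close> the triple product identity applied to
  \<open>t \<times> (w \<times> t)\<close> returns \<open>w\<close>, while \<open>w \<times> t = (w \<bullet> s) n - (w \<bullet> n) s\<close>.\<close>

lemma orthogonal_cross3_decompose:
  assumes ns: "(n, s) \<in> Delta" and "w \<bullet> cross3 n s = 0"
  shows "w = (w \<bullet> n) *\<^sub>R n + (w \<bullet> s) *\<^sub>R s"
proof -
  let ?t = "cross3 n s"
  note o = orthonormal_pair_cross3[OF ns]
  have wt: "cross3 w ?t = (w \<bullet> s) *\<^sub>R n - (w \<bullet> n) *\<^sub>R s"
    by (simp add: Lagrange)
  have tn: "cross3 ?t n = s" and ts: "cross3 ?t s = - n"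
    using Lagrange[of n n s] Lagrange[of s n s] cross_skew[of ?t n] cross_skew[of ?t s] o by auto
  have "w = cross3 ?t (cross3 w ?t)"
    using assms(2) o by (simp only: Lagrange[of ?t w ?t] inner_commute[of ?t w]) simp
  also have "\<dots> = (w \<bullet> n) *\<^sub>R n + (w \<bullet> s) *\<^sub>R s"
    by (simp add: wt Cross3.right_diff_distrib cross_mult_right tn ts)
  finally show ?thesis .
qed

lemma rotated_frame:
  assumes ns: "(n, s) \<in> Delta" and "c\<^sup>2 + d\<^sup>2 = (1::real)"
  shows "(c *\<^sub>R n + d *\<^sub>R s, - d *\<^sub>R n + c *\<^sub>R s) \<in> Delta"
    and "cross3 (c *\<^sub>R n + d *\<^sub>R s) (- d *\<^sub>R n + c *\<^sub>R s) = cross3 n s"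
proof -
  show "(c *\<^sub>R n + d *\<^sub>R s, - d *\<^sub>R n + c *\<^sub>R s) \<in> Delta"
    using assms(2) orthonormal_pair_cross3[OF ns]
    by (simp add: Delta_def norm_eq_1 inner_simps power2_eq_square algebra_simps)
  have "cross3 (c *\<^sub>R n + d *\<^sub>R s) (- d *\<^sub>R n + c *\<^sub>R s) = (c\<^sup>2 + d\<^sup>2) *\<^sub>R cross3 n s"
    by (simp add: cross_add_left cross_add_right cross_mult_left cross_mult_right cross_skew[of s n]
        Cross3.right_diff_distrib power2_eq_square algebra_simps)
  then show "cross3 (c *\<^sub>R n + d *\<^sub>R s) (- d *\<^sub>R n + c *\<^sub>R s) = cross3 n s"
    using assms(2) by simp
qed

section \<open>Bertrand mates along the third frame vector\<close>

text \<open>The derivative of \<open>x + \<lambda>t\<close> is tested only against vectors of the plane spanned by \<open>n\<close> and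
  \<open>s\<close>, because the first vector of every frame with third vector \<open>t\<close> lies there. This removes the
  multiples of \<open>t\<close>, among them the derivative of \<open>\<lambda>\<close>, so the condition on \<open>\<lambda>\<close> is algebraic.\<close>

lemma partial_deriv_parallel_inner:
  assumes U: "open U" "p \<in> U"
    and x: "framed_surface U x n s" and inv: "basic_invariants U x n s a b e f g"
    and l: "smooth_on l U"
    and x': "\<And>q. q \<in> U \<Longrightarrow> x' q = x q + l q *\<^sub>R t_field n s q"
  shows "partial_deriv i x' p \<bullet> (c *\<^sub>R n p + d *\<^sub>R s p) =
    - (l p * f i p) * c + (a i p - l p * g i p) * d"
proof -
  let ?t = "t_field n s" and ?D = "\<lambda>h. frechet_derivative h (at p)"
  have sm: "smooth_on x U" "smooth_on ?t U"
    using x U by (auto simp: framed_surface_def intro: smooth_on_t_field)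
  have "((\<lambda>q. x q + l q *\<^sub>R ?t q) has_derivative
      (\<lambda>h. ?D x h + (l p *\<^sub>R ?D ?t h + ?D l h *\<^sub>R ?t p))) (at p)"
    using sm l U(2)
    by (intro has_derivative_add has_derivative_scaleR smooth_on_imp_has_derivative)
  then have "(x' has_derivative
      (\<lambda>h. ?D x h + (l p *\<^sub>R ?D ?t h + ?D l h *\<^sub>R ?t p))) (at p)"
    by (rule has_derivative_transform_within_open[OF _ U]) (simp add: x')
  then have "partial_deriv i x' p =
      partial_deriv i x p + (l p *\<^sub>R partial_deriv i ?t p + partial_deriv i l p *\<^sub>R ?t p)"
    by (simp add: partial_deriv_def frechet_derivative_at[symmetric])
  also have "\<dots> = (a i p *\<^sub>R s p + b i p *\<^sub>R ?t p) +
      (l p *\<^sub>R (- f i p *\<^sub>R n p - g i p *\<^sub>R s p) + partial_deriv i l p *\<^sub>R ?t p)"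
    using inv U(2) by (simp add: basic_invariants_def)
  finally have D: "partial_deriv i x' p = \<dots>" .
  have "(n p, s p) \<in> Delta" using x U(2) by (simp add: framed_surface_def)
  then show ?thesis
    unfolding D t_field_def
    by (simp add: inner_simps orthonormal_pair_cross3 algebra_simps)
qed

lemma matrix_2_2_kernel_iff:
  "(vector [vector [p, q], vector [r, w]] :: real^2^2) *v (vector [y, z] :: real^2) = 0 \<longleftrightarrow>
    p * y + q * z = 0 \<and> r * y + w * z = 0"
  by (simp add: vec_eq_iff forall_2 matrix_vector_mult_def sum_2)

theorem theorem3p25:
  fixes U :: "(real^2) set"
    and x n s :: "real^2 \<Rightarrow> real^3"
    and a b e f g :: "2 \<Rightarrow> real^2 \<Rightarrow> real"
  assumes "open U" and "U \<noteq> {}" and "simply_connected U"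
    and "framed_surface U x n s"
    and "basic_invariants U x n s a b e f g"
  shows "Bertrand_framed_surface Frame_t Frame_t U x n s \<longleftrightarrow>
    (\<exists>l \<theta> :: real^2 \<Rightarrow> real. smooth_on l U \<and> smooth_on \<theta> U \<and> densely_nonzero U l \<and>
       (\<forall>p\<in>U.
          (vector [vector [l p * f 1 p, a 1 p - l p * g 1 p],
                   vector [l p * f 2 p, a 2 p - l p * g 2 p]] :: real^2^2)
            *v (vector [cos (\<theta> p), sin (\<theta> p)] :: real^2) = 0))"
    (is "_ \<longleftrightarrow> ?R")
proof
  have ns: "\<And>p. p \<in> U \<Longrightarrow> (n p, s p) \<in> Delta" and sm: "smooth_on x U" "smooth_on n U" "smooth_on s U"
    using assms(4) by (auto simp: framed_surface_def)
  note inner = partial_deriv_parallel_inner[OF assms(1) _ assms(4,5)]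
  {
    assume "Bertrand_framed_surface Frame_t Frame_t U x n s"
    then obtain x' n' s' l where fs': "framed_surface U x' n' s'"
      and l: "smooth_on l U" "densely_nonzero U l"
      and x': "\<And>p. p \<in> U \<Longrightarrow> x' p = x p + l p *\<^sub>R t_field n s p"
      and t': "\<And>p. p \<in> U \<Longrightarrow> t_field n s p = t_field n' s' p"
      by (auto simp: Bertrand_framed_surface_def mates_def)
    \<comment> \<open>\<open>n'\<close> is orthogonal to \<open>t' = t\<close>, so it lies in the plane of \<open>n\<close> and \<open>s\<close>.\<close>
    define c d where "c p = n' p \<bullet> n p" and "d p = n' p \<bullet> s p" for p
    have n': "n' p = c p *\<^sub>R n p + d p *\<^sub>R s p" if "p \<in> U" for p
      unfolding c_def d_def using t'[OF that]
      by (intro orthogonal_cross3_decompose[OF ns[OF that]]) (simp add: t_field_def dot_cross_self)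
    have unit: "(- c p)\<^sup>2 + (d p)\<^sup>2 = 1" if "p \<in> U" for p
    proof -
      have "(n' p, s' p) \<in> Delta" using fs' that by (simp add: framed_surface_def)
      then have "n' p \<bullet> n' p = 1" by (rule orthonormal_pair_cross3)
      then show ?thesis
        using n'[OF that] orthonormal_pair_cross3[OF ns[OF that]]
        by (simp add: inner_simps power2_eq_square)
    qed
    have "smooth_on n' U" using fs' by (simp add: framed_surface_def)
    then have "smooth_on (\<lambda>p. - c p) U" "smooth_on d U"
      unfolding c_def d_def using sm by (auto intro!: smooth_on_intros[OF assms(1)])
    from smooth_on_angle_exists[OF assms(1,3) this unit]
    obtain \<theta> where \<theta>: "smooth_on \<theta> U"
      "\<And>p. p \<in> U \<Longrightarrow> cos (\<theta> p) = - c p" "\<And>p. p \<in> U \<Longrightarrow> sin (\<theta> p) = d p" by blast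
    have "l p * f i p * cos (\<theta> p) + (a i p - l p * g i p) * sin (\<theta> p) = 0" if "p \<in> U" for i p
    proof -
      have "partial_deriv i x' p \<bullet> (c p *\<^sub>R n p + d p *\<^sub>R s p) = 0"
        using fs' that n' by (simp add: framed_surface_def)
      then show ?thesis using inner[OF that l(1) x'] \<theta> that by simp
    qed
    then show ?R
      using l \<theta>(1) by (intro exI[of _ l] exI[of _ \<theta>]) (simp add: matrix_2_2_kernel_iff)
  next
    assume ?R
    then obtain l \<theta> where l: "smooth_on l U" "densely_nonzero U l" and \<theta>: "smooth_on \<theta> U"
      and eq: "\<And>p. p \<in> U \<Longrightarrow>
        \<forall>i. l p * f i p * cos (\<theta> p) + (a i p - l p * g i p) * sin (\<theta> p) = 0"
      by (auto simp: matrix_2_2_kernel_iff forall_2)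
    define x' where "x' p = x p + l p *\<^sub>R t_field n s p" for p
    define n' where "n' p = - cos (\<theta> p) *\<^sub>R n p + sin (\<theta> p) *\<^sub>R s p" for p
    \<comment> \<open>The quarter turn of \<open>n'\<close> about \<open>t\<close>, in the direction that makes \<open>n' \<times> s'\<close> equal to
      \<open>t\<close> rather than \<open>-t\<close>.\<close>
    define s' where "s' p = - sin (\<theta> p) *\<^sub>R n p + - cos (\<theta> p) *\<^sub>R s p" for p
    have "smooth_on x' U" "smooth_on n' U" "smooth_on s' U"
      unfolding x'_def n'_def s'_def
      by (intro smooth_on_intros[OF assms(1)] smooth_on_t_field[OF assms(1)] sm l(1) \<theta>)+
    moreover have "(n' p, s' p) \<in> Delta \<and> t_field n' s' p = t_field n s p" if "p \<in> U" for p
      using rotated_frame[OF ns[OF that], of "- cos (\<theta> p)" "sin (\<theta> p)"]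
      by (simp add: n'_def s'_def t_field_def)
    moreover have "partial_deriv i x' p \<bullet> n' p = 0" if "p \<in> U" for i p
      using inner[OF that l(1) x'_def, of i "- cos (\<theta> p)" "sin (\<theta> p)"] eq[OF that]
      by (simp add: n'_def)
    ultimately have "mates Frame_t Frame_t U x n s x' n' s'"
      using assms(4) l x'_def by (auto simp: mates_def framed_surface_def)
    then show "Bertrand_framed_surface Frame_t Frame_t U x n s"
      by (auto simp: Bertrand_framed_surface_def)
  }
qed

end
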